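(* Let $n>2$ and let $G=\{0,1,\dots,n-2\}$ be the cyclic group of order $n-1$ under addition modulo $n-1$. Let $M=G\cup\{\infty\}$ with the operation extending that of $G$ by $\infty+\infty=\infty$ and $g+\infty=\infty+g=\infty$ for all $g\in G$. Then $M$ is a commutative monoid of order $n$ with exactly two idempotents, and $M$ is not isomorphic to the sandpile monoid $\mathcal{M}(\widehat{X})$ of any sandpile graph $\widehat{X}$.
   Context: A sandpile graph $\widehat{X}$ is a finite weakly connected directed multigraph (loops and multiple edges allowed) with a distinguished vertex, the sink, reachable by a directed path from every vertex; the set of non-sink vertices is nonempty. A configuration assigns a nonnegative integer number of grains to each non-sink vertex; it is stable if every $v$ holds fewer than $\deg^{+}(v)$ (out-degree) grains. Toppling an unstable vertex sends one grain along each of its out-edges (grains at the sink vanish; the sink never topples); every configuration has a unique stabilization. The sandpile monoid $\mathcal{M}(\widehat X)$ is the set of stable configurations with $a\oplus b$ = stabilization of $a+b$. *)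

theory Defs
  imports "HOL-Algebra.Elementary_Groups" "Graph_Theory.Digraph_Component"
begin

locale sandpile_graph = fin_digraph X for X :: "('a, 'b) pre_digraph" +
  fixes sink :: 'a
  assumes weakly_connected: "Digraph_Component.connected X"
    and sink_in_verts: "sink \<in> verts X"
    and sink_reachable: "\<And>v. v \<in> verts X \<Longrightarrow> v \<rightarrow>\<^sup>*\<^bsub>X\<^esub> sink"
    and nonsink_nonempty: "verts X - {sink} \<noteq> {}"

text \<open>
  A configuration is a function on all of \<^typ>\<open>'a\<close> that is normalised to 0 off the non-sink
  vertices, so that equality of configurations is equality of functions.
\<close>

definition configs :: "('a, 'b) pre_digraph \<Rightarrow> 'a \<Rightarrow> ('a \<Rightarrow> nat) set" where
  "configs X s = {c. \<forall>v. v \<notin> verts X - {s} \<longrightarrow> c v = 0}"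

definition stable :: "('a, 'b) pre_digraph \<Rightarrow> 'a \<Rightarrow> ('a \<Rightarrow> nat) \<Rightarrow> bool" where
  "stable X s c \<longleftrightarrow> (\<forall>v \<in> verts X - {s}. c v < out_degree X v)"

definition arc_count :: "('a, 'b) pre_digraph \<Rightarrow> 'a \<Rightarrow> 'a \<Rightarrow> nat" where
  "arc_count X v w = card {e \<in> out_arcs X v. head X e = w}"

text \<open>
  A loop at \<open>v\<close> counts towards the out-degree of \<open>v\<close> and returns its grain to \<open>v\<close>. The natural
  subtraction below does not truncate, as only unstable vertices are toppled.
\<close>

definition topple :: "('a, 'b) pre_digraph \<Rightarrow> 'a \<Rightarrow> 'a \<Rightarrow> ('a \<Rightarrow> nat) \<Rightarrow> ('a \<Rightarrow> nat)" where
  "topple X s v c =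
    (\<lambda>w. if w \<in> verts X - {s}
         then (if w = v then c w - out_degree X v else c w) + arc_count X v w
         else 0)"

inductive toppling_step ::
    "('a, 'b) pre_digraph \<Rightarrow> 'a \<Rightarrow> ('a \<Rightarrow> nat) \<Rightarrow> ('a \<Rightarrow> nat) \<Rightarrow> bool" for X s where
  "v \<in> verts X - {s} \<Longrightarrow> out_degree X v \<le> c v \<Longrightarrow> toppling_step X s c (topple X s v c)"

definition stabilization :: "('a, 'b) pre_digraph \<Rightarrow> 'a \<Rightarrow> ('a \<Rightarrow> nat) \<Rightarrow> ('a \<Rightarrow> nat)" where
  "stabilization X s c = (THE d. (toppling_step X s)\<^sup>*\<^sup>* c d \<and> stable X s d)"

definition sandpile_monoid :: "('a, 'b) pre_digraph \<Rightarrow> 'a \<Rightarrow> ('a \<Rightarrow> nat) monoid" where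
  "sandpile_monoid X s =
    \<lparr>carrier = {c \<in> configs X s. stable X s c},
     monoid.mult = (\<lambda>a b. stabilization X s (\<lambda>v. a v + b v)),
     one = (\<lambda>_. 0)\<rparr>"

text \<open>\<^const>\<open>None\<close> plays the role of the adjoined absorbing element \<open>\<infinity>\<close>.\<close>

definition adjoin_infinity :: "('a, 'm) monoid_scheme \<Rightarrow> 'a option monoid" where
  "adjoin_infinity G =
    \<lparr>carrier = Some ` carrier G \<union> {None},
     monoid.mult = (\<lambda>x y. case (x, y) of
        (Some g, Some h) \<Rightarrow> Some (g \<otimes>\<^bsub>G\<^esub> h)
      | _ \<Rightarrow> None),
     one = Some \<one>\<^bsub>G\<^esub>\<rparr>"

end

theory Submission
  imports Defs
begin

text \<open>
  The element \<open>\<infinity>\<close> is absorbing, and it is prime: a sum equals \<open>\<infinity>\<close> only if a summand does. In a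
  sandpile monoid let \<open>z\<close> be absorbing and prime. No toppling occurs in a sum of stable
  configurations that is already stable. Splitting one grain at \<open>v\<close> off \<open>z\<close> and using that \<open>z\<close> is
  prime shows that \<open>z\<close> is this single grain. As \<open>z\<close> is absorbing, every stable configuration
  with a grain at \<open>v\<close> equals \<open>z\<close>; adding \<open>z\<close> to a stable configuration without a grain at \<open>v\<close>
  keeps it stable, so such a configuration is 0. Hence there are at most two stable configurations.
\<close>

lemma carrier_adjoin_infinity [simp]:
  "carrier (adjoin_infinity G) = Some ` carrier G \<union> {None}"
  by (simp add: adjoin_infinity_def)

lemma mult_adjoin_infinity [simp]:
  "Some g \<otimes>\<^bsub>adjoin_infinity G\<^esub> Some h = Some (g \<otimes>\<^bsub>G\<^esub> h)"
  "x \<otimes>\<^bsub>adjoin_infinity G\<^esub> None = None"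
  "None \<otimes>\<^bsub>adjoin_infinity G\<^esub> x = None"
  by (simp_all add: adjoin_infinity_def split: option.split)

lemma one_adjoin_infinity [simp]: "\<one>\<^bsub>adjoin_infinity G\<^esub> = Some \<one>\<^bsub>G\<^esub>"
  by (simp add: adjoin_infinity_def)

text \<open>The primality of \<open>None\<close>; together with absorption it is what an isomorphism
  carries over to a sandpile monoid.\<close>

lemma mult_adjoin_infinity_eq_None_iff:
  "x \<otimes>\<^bsub>adjoin_infinity G\<^esub> y = None \<longleftrightarrow> x = None \<or> y = None"
  by (cases x; cases y) simp_all

lemma comm_monoid_adjoin_infinity:
  assumes "comm_monoid G"
  shows "comm_monoid (adjoin_infinity G)"
proof -
  interpret comm_monoid G by fact
  show ?thesis
    by (rule comm_monoidI) (auto simp: m_assoc intro: m_comm)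
qed

lemma order_adjoin_infinity:
  assumes "finite (carrier G)"
  shows "order (adjoin_infinity G) = Suc (order G)"
  using assms by (simp add: order_def card_image)

text \<open>Cancellation leaves the identity as the only idempotent of a group.\<close>

lemma idempotents_adjoin_infinity:
  assumes "group G"
  shows "{e \<in> carrier (adjoin_infinity G). e \<otimes>\<^bsub>adjoin_infinity G\<^esub> e = e} = {Some \<one>\<^bsub>G\<^esub>, None}"
proof -
  interpret group G by fact
  show ?thesis
    by auto
qed

text \<open>No toppling step starts from a stable configuration, so \<open>c\<close> is the only
  configuration reachable from it.\<close>

lemma stabilization_stable:
  assumes "stable X s c"
  shows "stabilization X s c = c"
proof -
  have "d = c" if "(toppling_step X s)\<^sup>*\<^sup>* c d" for d
    using that
  proof (cases rule: converse_rtranclpE)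
    case (step c')
    with assms show ?thesis
      by (metis leD stable_def toppling_step.cases)
  qed simp
  with assms show ?thesis
    unfolding stabilization_def by blast
qed

lemma mult_sandpile_monoid_stable:
  assumes "(\<lambda>v. a v + b v) \<in> carrier (sandpile_monoid X s)"
  shows "a \<otimes>\<^bsub>sandpile_monoid X s\<^esub> b = (\<lambda>v. a v + b v)"
  using assms by (simp add: sandpile_monoid_def stabilization_stable)

lemma carrier_sandpile_monoid_downward:
  assumes "c \<in> carrier (sandpile_monoid X s)" and "\<And>v. d v \<le> c v"
  shows "d \<in> carrier (sandpile_monoid X s)"
  using assms unfolding sandpile_monoid_def configs_def stable_def
  by simp (metis le_less_trans le_zero_eq)

lemma carrier_sandpile_monoid_prime_absorbing:
  fixes X :: "('a, 'b) pre_digraph" and s :: 'a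
  defines "S \<equiv> sandpile_monoid X s"
  assumes z: "z \<in> carrier S"
    and absorbing: "\<And>c. c \<in> carrier S \<Longrightarrow> z \<otimes>\<^bsub>S\<^esub> c = z"
    and prime: "\<And>c d. c \<in> carrier S \<Longrightarrow> d \<in> carrier S \<Longrightarrow> c \<otimes>\<^bsub>S\<^esub> d = z \<Longrightarrow> c = z \<or> d = z"
  shows "carrier S \<subseteq> {\<lambda>_. 0, z}"
proof
  fix c assume c: "c \<in> carrier S"
  note down = carrier_sandpile_monoid_downward[of _ X s, folded S_def]
  note mult = mult_sandpile_monoid_stable[of _ _ X s, folded S_def]
  show "c \<in> {\<lambda>_. 0, z}"
  \<comment> \<open>If \<open>z\<close> is the empty configuration, it is both neutral and
    absorbing, so \<open>c\<close> equals \<open>z\<close>.\<close>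
  proof (cases "z = (\<lambda>_. 0)")
    case True
    then have "z \<otimes>\<^bsub>S\<^esub> c = c"
      using mult[of z c] c by simp
    with absorbing[OF c] show ?thesis by simp
  next
    case False
    then obtain v where v: "z v > 0" by auto
    define g where "g = (\<lambda>w. if w = v then 1 else 0 :: nat)"
    define r where "r = (\<lambda>w. z w - g w)"
    have sum: "(\<lambda>w. g w + r w) = z"
      using v by (auto simp: g_def r_def)
    have "g \<in> carrier S" and "r \<in> carrier S"
      using v by (auto intro!: down[OF z] simp: g_def r_def)
    moreover have "g \<otimes>\<^bsub>S\<^esub> r = z"
      using mult[of g r] sum z by simp
    moreover have "r \<noteq> z"
      using v by (auto simp: r_def g_def fun_eq_iff)
    ultimately have zg: "z = g"
      using prime[of g r] by metis
    \<comment> \<open>Such a \<open>d\<close> is the product of \<open>z\<close>, now a single grain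
      at \<open>v\<close>, with the remaining grains, and \<open>z\<close> absorbs these.\<close>
    have eq_z: "d = z" if d: "d \<in> carrier S" "d v > 0" for d
    proof -
      have "(\<lambda>w. z w + (d w - g w)) = d"
        using d(2) by (auto simp: zg g_def)
      moreover have "(\<lambda>w. d w - g w) \<in> carrier S"
        by (rule down[OF d(1)]) simp
      ultimately show ?thesis
        using mult[of z "\<lambda>w. d w - g w"] absorbing[of "\<lambda>w. d w - g w"] d(1) by simp
    qed
    show ?thesis
    proof (cases "c v = 0")
      case True
      \<comment> \<open>The supports are disjoint: the sum agrees with \<open>z\<close> at
        \<open>v\<close> and with \<open>c\<close> elsewhere.\<close>
      have "(\<lambda>w. c w + z w) \<in> carrier S"
        using c z True unfolding S_def zg g_def
        by (auto simp: sandpile_monoid_def configs_def stable_def dest: bspec[of _ _ v])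
      then have "(\<lambda>w. c w + z w) = z"
        by (rule eq_z) (use v in simp)
      then show ?thesis by (auto simp: fun_eq_iff)
    next
      case False
      with eq_z c show ?thesis by simp
    qed
  qed
qed

lemma adjoin_infinity_not_iso_sandpile_monoid:
  assumes "monoid G" and "order G \<ge> 2"
  shows "\<not> adjoin_infinity G \<cong> sandpile_monoid X s"
proof
  let ?M = "adjoin_infinity G" and ?S = "sandpile_monoid X s"
  assume "?M \<cong> ?S"
  then obtain h where h: "h \<in> hom ?M ?S" and bij: "bij_betw h (carrier ?M) (carrier ?S)"
    by (auto simp: is_iso_def iso_def)
  have image: "h ` carrier ?M = carrier ?S"
    using bij by (rule bij_betw_imp_surj_on)
  have mult: "h (x \<otimes>\<^bsub>?M\<^esub> y) = h x \<otimes>\<^bsub>?S\<^esub> h y" if "x \<in> carrier ?M" "y \<in> carrier ?M" for x y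
    using h that by (rule hom_mult)
  have None: "None \<in> carrier ?M" by simp
  have "carrier ?S \<subseteq> {\<lambda>_. 0, h None}"
  proof (rule carrier_sandpile_monoid_prime_absorbing)
    show "h None \<in> carrier ?S" using image None by blast
  next
    fix c assume "c \<in> carrier ?S"
    then obtain x where "x \<in> carrier ?M" "c = h x" using image by blast
    with mult[OF None] show "h None \<otimes>\<^bsub>?S\<^esub> c = h None"
      by (metis mult_adjoin_infinity(3))
  next
    fix c d assume "c \<in> carrier ?S" "d \<in> carrier ?S" and cd: "c \<otimes>\<^bsub>?S\<^esub> d = h None"
    then obtain x y where x: "x \<in> carrier ?M" "c = h x" and y: "y \<in> carrier ?M" "d = h y"
      using image by blast
    \<comment> \<open>Injectivity of \<open>h\<close> is available on the carrier only.\<close>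
    have "x \<otimes>\<^bsub>?M\<^esub> y \<in> carrier ?M"
      using x(1) y(1) monoid.m_closed[OF assms(1)] by auto
    then have "x \<otimes>\<^bsub>?M\<^esub> y = None"
      using cd mult[OF x(1) y(1)] x(2) y(2) bij None
      by (metis bij_betw_imp_inj_on inj_onD)
    then show "c = h None \<or> d = h None"
      using x y by (auto simp: mult_adjoin_infinity_eq_None_iff)
  qed
  then have "card (carrier ?S) \<le> card {\<lambda>_. 0, h None}"
    by (intro card_mono) simp_all
  also have "\<dots> \<le> 2"
    by (simp add: card_insert_if)
  finally have "card (carrier ?S) \<le> 2" .
  moreover have "card (carrier ?S) = order ?M"
    using bij_betw_same_card[OF bij] by (simp add: order_def)
  \<comment> \<open>An infinite carrier would have \<open>order\<close> 0.\<close>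
  moreover have "finite (carrier G)"
    using assms(2) by (intro card_ge_0_finite) (simp add: order_def)
  ultimately show False
    using assms by (simp add: order_adjoin_infinity)
qed

theorem theorem5p4:
  fixes n :: nat and M :: "int option monoid"
  assumes "n > 2"
    and "M = adjoin_infinity (integer_mod_group (n - 1))"
  shows "comm_monoid M \<and> order M = n
    \<and> card {e \<in> carrier M. e \<otimes>\<^bsub>M\<^esub> e = e} = 2
    \<and> (\<forall>(X :: ('a, 'b) pre_digraph) s. sandpile_graph X s \<longrightarrow> \<not> M \<cong> sandpile_monoid X s)"
proof -
  let ?G = "integer_mod_group (n - 1)"
  \<comment> \<open>The modulus is positive; for modulus 0 \<open>integer_mod_group\<close> is the
    infinite group of integers.\<close>
  have finite: "finite (carrier ?G)" and order: "order ?G = n - 1"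
    using assms(1) by (simp_all add: order_def carrier_integer_mod_group)
  interpret comm_group ?G by simp
  have "comm_monoid M"
    unfolding assms(2) by (intro comm_monoid_adjoin_infinity comm_monoid_axioms)
  moreover have "order M = n"
    using assms order_adjoin_infinity[OF finite] order by simp
  moreover have "card {e \<in> carrier M. e \<otimes>\<^bsub>M\<^esub> e = e} = 2"
    unfolding assms(2) idempotents_adjoin_infinity[OF is_group] by simp
  moreover have "\<not> M \<cong> sandpile_monoid X s" for X :: "('a, 'b) pre_digraph" and s
    unfolding assms(2)
    by (rule adjoin_infinity_not_iso_sandpile_monoid[OF monoid_axioms]) (use assms(1) order in simp)
  ultimately show ?thesis by blast
qed

end
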